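(* Let $N\ge 2$, $k\in\{2,\dots,N\}$, $\varepsilon\in[0,1)$, let $I\subset\mathbb{R}$ be a compact interval and $f:I\to I$ a piecewise $C^1$ map such that $$\sup|f'|<(1-\varepsilon)^{\frac{k-N}{N-k+1}}.$$ Let $\tilde F_\varepsilon:I^{N-k+1}\to I^{N-k+1}$ be the reduced coupled map lattice describing the dynamics, on a cluster space of size $k$, of the globally coupled map lattice with $N$ sites, local map $f$ and coupling $\varepsilon$. Then $\tilde F_\varepsilon$ admits no invariant probability measure that is absolutely continuous with respect to the $(N-k+1)$-dimensional Lebesgue measure.
   Context: The globally coupled map lattice on $I^N$ is $F_\varepsilon(x)_i=(1-\varepsilon)f(x_i)+\frac{\varepsilon}{N}\sum_{j=1}^N f(x_j)$, $1\le i\le N$. For $J\subset\{1,\dots,N\}$ with $\#J=k$, the cluster space $\mathcal{C}_J=\{x\in I^N: x_i=x_j\ \forall i,j\in J\}$ is forward invariant, and the restriction of $F_\varepsilon$ to $\mathcal{C}_J$ is identified with the map $\tilde F_\varepsilon$ on $\tilde X=I^{N-k+1}$ (the first coordinate $\tilde x_1$ being the common value of the sites in $J$) defined by $$\tilde F_\varepsilon(\tilde x)_i=(1-\varepsilon)f(\tilde x_i)+\frac{\varepsilon}{N}\Big(k f(\tilde x_1)+\sum_{j=2}^{N-k+1} f(\tilde x_j)\Big),\qquad 1\le i\le N-k+1.$$ Piecewise $C^1$ means that $I$ can be partitioned into finitely many intervals on the interior of each of which $f$ is $C^1$; $\sup|f'|$ is taken over the points where $f'$ is defined. *)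

theory Defs
  imports "HOL-Analysis.Analysis" "HOL-Probability.Probability"
begin

text \<open>The library's \<open>piecewise_C1_differentiable_on\<close> demands continuity on the whole set, so it
  is not the notion wanted here: \<open>f\<close> may jump, and \<open>f'\<close> need not extend, at the partition points.\<close>

definition piecewise_C1_on :: "(real \<Rightarrow> real) \<Rightarrow> real set \<Rightarrow> bool" where
  "piecewise_C1_on f I \<longleftrightarrow>
     (\<exists>P. finite P \<and> partition_on I P \<and>
          (\<forall>J\<in>P. is_interval J \<and> f C1_differentiable_on interior J))"

text \<open>The supremum is taken in \<^typ>\<open>ereal\<close>, so that it is \<open>\<infinity>\<close> if \<open>f'\<close> is unbounded. Only the
  interior of \<open>I\<close> is considered, so the values of \<open>f\<close> outside \<open>I\<close> play no role; for a
  piecewise \<open>C\<^sup>1\<close> map, one-sided derivatives at the end points would not change the supremum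
  (mean value theorem).\<close>

definition sup_abs_deriv :: "(real \<Rightarrow> real) \<Rightarrow> real set \<Rightarrow> ereal" where
  "sup_abs_deriv f I =
     (SUP x\<in>{x \<in> interior I. f field_differentiable at x}. ereal \<bar>deriv f x\<bar>)"

definition cube :: "real set \<Rightarrow> (real ^ 'd::finite) set" where
  "cube I = {x. \<forall>i. x $ i \<in> I}"

text \<open>The \<open>N - k + 1\<close> coordinates are indexed by the finite type \<open>'d\<close>; the index \<open>c\<close> stands for
  the cluster coordinate (the first one in the usual numbering).\<close>

definition reduced_map ::
  "nat \<Rightarrow> nat \<Rightarrow> real \<Rightarrow> (real \<Rightarrow> real) \<Rightarrow> 'd \<Rightarrow> real ^ 'd::finite \<Rightarrow> real ^ 'd" where
  "reduced_map N k \<epsilon> f c x =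
     (\<chi> i. (1 - \<epsilon>) * f (x $ i)
          + \<epsilon> / real N * (real k * f (x $ c) + (\<Sum>j\<in>UNIV - {c}. f (x $ j))))"

definition invariant_measure :: "'a measure \<Rightarrow> ('a \<Rightarrow> 'a) \<Rightarrow> bool" where
  "invariant_measure M T \<longleftrightarrow>
     (\<forall>A\<in>sets M. emeasure M (T -` A \<inter> space M) = emeasure M A)"

end

theory Submission imports Defs begin

text \<open>On the points all of whose coordinates lie in the interiors of the pieces, the Jacobian
  determinant of the reduced map is \<open>(1 - \<epsilon>) ^ (N - k)\<close> times a product of \<open>N - k + 1\<close> values of
  \<open>f'\<close>, so by hypothesis it is bounded by some \<open>q < 1\<close> and the map contracts volume by the factor
  \<open>q\<close>. If \<open>A\<close> has full measure for an invariant probability, so has every Borel set containing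
  the image of \<open>A\<close>. Iterating, there are sets of full measure and arbitrarily small volume, hence a null set of
  full measure, which absolute continuity forbids.\<close>

section \<open>Determinants of the coupling matrix\<close>

text \<open>In the Leibniz formula every permutation other than the identity contributes zero: it
  moves some index \<open>i \<noteq> c\<close>, since fixing all of these would force it, by
  injectivity, to fix \<open>c\<close> too, and the factor of its term in row \<open>i\<close> is
  then off the diagonal.\<close>

lemma det_diagonal_off_row:
  fixes A :: "'a::comm_ring_1^'n^'n"
  assumes "\<And>i j. i \<noteq> c \<Longrightarrow> i \<noteq> j \<Longrightarrow> A $ i $ j = 0"
  shows "det A = (\<Prod>i\<in>UNIV. A $ i $ i)"
proof -
  let ?term = "\<lambda>p. of_int (sign p) * (\<Prod>i\<in>UNIV. A $ i $ p i)"
  have zero: "?term p = 0" if "p permutes (UNIV :: 'n set)" "p \<noteq> id" for p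
  proof -
    have "\<exists>i. i \<noteq> c \<and> p i \<noteq> i"
    proof (rule ccontr)
      assume "\<not> ?thesis"
      then have fix_off_c: "\<And>i. i \<noteq> c \<Longrightarrow> p i = i" by blast
      moreover have "p c = c"
        using fix_off_c[of "p c"] permutes_inj[OF that(1)] by (metis injD)
      ultimately have "p = id" by (metis eq_id_iff)
      with that show False by simp
    qed
    then have "\<exists>i\<in>UNIV. A $ i $ p i = 0" using assms by (metis UNIV_I)
    then have "(\<Prod>i\<in>UNIV. A $ i $ p i) = 0" by (rule prod_zero[OF finite])
    then show ?thesis by simp
  qed
  have "det A = (\<Sum>p\<in>{id}. ?term p)"
    unfolding det_def
    by (rule sum.mono_neutral_right) (auto simp: finite_permutations permutes_id zero)
  then show ?thesis by (simp add: sign_id)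
qed

text \<open>The vector of ones is an eigenvector of the coupling matrix; passing to a basis that
  contains it leaves a matrix that is diagonal off row \<open>c\<close>.\<close>

lemma det_scalar_plus_constant_columns:
  fixes w :: "'n::finite \<Rightarrow> 'a::idom"
  assumes "s + sum w UNIV = 1"
  shows "det (\<chi> i j. (if i = j then s else 0) + w j :: 'a^'n^'n) = s ^ (CARD('n) - 1)"
proof -
  fix c :: 'n
  define L :: "'a^'n^'n" where "L = (\<chi> i j. (if i = j then s else 0) + w j)"
  \<comment> \<open>\<open>B\<close> is the identity with column \<open>c\<close> replaced by the
    vector of ones, and \<open>G\<close> is \<open>L\<close> written in the basis of the columns of
    \<open>B\<close>: \<open>L\<close> fixes the vector of ones because
    \<open>s + sum w UNIV = 1\<close>, and it sends the \<open>j\<close>-th unit vector to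
    \<open>s\<close> times itself plus \<open>w j\<close> times the vector of ones.\<close>
  define B :: "'a^'n^'n" where "B = (\<chi> i j. if j = c then 1 else if i = j then 1 else 0)"
  define G :: "'a^'n^'n" where
    "G = (\<chi> i j. if i = c then (if j = c then 1 else w j) else if i = j then s else 0)"
  have "L ** B = B ** G"
  proof -
    have "(\<Sum>m\<in>UNIV. L $ i $ m * B $ m $ j) = (\<Sum>m\<in>UNIV. B $ i $ m * G $ m $ j)" for i j
    proof (cases "j = c")
      case True
      have "(\<Sum>m\<in>UNIV. L $ i $ m * B $ m $ j) = s + sum w UNIV"
        using True by (simp add: L_def B_def sum.distrib)
      moreover have "(\<Sum>m\<in>UNIV. B $ i $ m * G $ m $ j) = (\<Sum>m\<in>UNIV. if m = c then 1 else 0)"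
        using True by (intro sum.cong) (auto simp: B_def G_def)
      ultimately show ?thesis using assms by simp
    next
      case False
      have "(\<Sum>m\<in>UNIV. L $ i $ m * B $ m $ j) = (\<Sum>m\<in>UNIV. if m = j then L $ i $ j else 0)"
        using False by (intro sum.cong) (auto simp: B_def)
      moreover have "(\<Sum>m\<in>UNIV. B $ i $ m * G $ m $ j)
          = (\<Sum>m\<in>UNIV. (if m = c then w j else 0) + (if m = j then (if i = j then s else 0) else 0))"
        using False by (intro sum.cong) (auto simp: B_def G_def)
      ultimately show ?thesis by (simp add: L_def sum.distrib)
    qed
    then show ?thesis by (simp add: matrix_matrix_mult_def vec_eq_iff)
  qed
  then have "det L * det B = det B * det G"
    by (metis det_mul)
  moreover have "det B = 1"
  proof -
    \<comment> \<open>\<open>B\<close> is diagonal off column \<open>c\<close>, so its transpose is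
      diagonal off row \<open>c\<close>.\<close>
    have "det (transpose B) = (\<Prod>i\<in>UNIV. transpose B $ i $ i)"
      by (rule det_diagonal_off_row[of c]) (auto simp: transpose_def B_def)
    also have "\<dots> = 1"
      by (rule prod.neutral) (simp add: transpose_def B_def)
    finally show ?thesis by (simp add: det_transpose)
  qed
  moreover have "det G = s ^ (CARD('n) - 1)"
  proof -
    have "det G = (\<Prod>i\<in>UNIV. G $ i $ i)"
      by (rule det_diagonal_off_row[of c]) (auto simp: G_def)
    also have "\<dots> = G $ c $ c * (\<Prod>i\<in>UNIV - {c}. G $ i $ i)"
      by (rule prod.remove) auto
    also have "(\<Prod>i\<in>UNIV - {c}. G $ i $ i) = (\<Prod>i\<in>UNIV - {c}. s)"
      by (rule prod.cong) (auto simp: G_def)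
    finally show ?thesis by (simp add: G_def)
  qed
  ultimately show ?thesis
    by (simp add: L_def)
qed

section \<open>Derivative and Jacobian determinant of the reduced map\<close>

lemma has_derivative_vec_lambda:
  fixes g :: "'n::finite \<Rightarrow> 'a::real_normed_vector \<Rightarrow> real"
  assumes "\<And>i. (g i has_derivative g' i) F"
  shows "((\<lambda>x. \<chi> i. g i x) has_derivative (\<lambda>v. \<chi> i. g' i v)) F"
proof -
  \<comment> \<open>Expanding the vector over the unit vectors turns it into a finite sum of scalar
    functions times constants, to which the usual derivative rules apply.\<close>
  have eq: "(\<lambda>x. \<chi> i. h i x) = (\<lambda>x. \<Sum>i\<in>UNIV. h i x *\<^sub>R axis i 1)" for h :: "'n \<Rightarrow> 'a \<Rightarrow> real"
    by (auto simp: fun_eq_iff vec_eq_iff axis_def if_distrib cong: if_cong)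
  show ?thesis unfolding eq by (intro derivative_intros assms)
qed

text \<open>The coupling matrix with its column \<open>j\<close> scaled by \<open>d (x $ j)\<close>;
  here \<open>d\<close> stands for the derivative of the local map.\<close>

definition reduced_jacobian ::
  "nat \<Rightarrow> nat \<Rightarrow> real \<Rightarrow> (real \<Rightarrow> real) \<Rightarrow> 'd::finite \<Rightarrow> real ^ 'd \<Rightarrow> real ^ 'd ^ 'd" where
  "reduced_jacobian N k \<epsilon> d c x =
     (\<chi> i j. ((if i = j then 1 - \<epsilon> else 0) + \<epsilon> / real N * (if j = c then real k else 1)) * d (x $ j))"

lemma sum_split_off:
  fixes c :: "'d::finite" and h :: "'d \<Rightarrow> real"
  shows "(\<Sum>j\<in>UNIV. (if j = c then r else 1) * h j) = r * h c + (\<Sum>j\<in>UNIV - {c}. h j)"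
proof -
  have "(\<Sum>j\<in>UNIV. (if j = c then r else 1) * h j)
      = r * h c + (\<Sum>j\<in>UNIV - {c}. (if j = c then r else 1) * h j)"
    by (subst sum.remove[of _ c]) auto
  also have "(\<Sum>j\<in>UNIV - {c}. (if j = c then r else 1) * h j) = (\<Sum>j\<in>UNIV - {c}. h j)"
    by (rule sum.cong) auto
  finally show ?thesis .
qed

lemma reduced_map_has_derivative:
  fixes x :: "real ^ 'd::finite"
  assumes "\<And>i. (f has_real_derivative d (x $ i)) (at (x $ i))"
  shows "(reduced_map N k \<epsilon> f c has_derivative (*v) (reduced_jacobian N k \<epsilon> d c x)) (at x within S)"
proof -
  have comp: "((\<lambda>y. f (y $ i)) has_derivative (\<lambda>v. d (x $ i) * v $ i)) (at x within S)" for i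
    using has_derivative_compose[OF bounded_linear_imp_has_derivative[OF bounded_linear_vec_nth]
        assms[of i, unfolded has_field_derivative_def]] .
  have "(reduced_map N k \<epsilon> f c has_derivative
     (\<lambda>v. \<chi> i. (1 - \<epsilon>) * (d (x $ i) * v $ i)
          + \<epsilon> / real N * (real k * (d (x $ c) * v $ c) + (\<Sum>j\<in>UNIV - {c}. d (x $ j) * v $ j))))
     (at x within S)"
    unfolding reduced_map_def
    by (intro has_derivative_vec_lambda has_derivative_add has_derivative_mult_right
        has_derivative_sum comp)
  moreover have "(\<chi> i. (1 - \<epsilon>) * (d (x $ i) * v $ i)
          + \<epsilon> / real N * (real k * (d (x $ c) * v $ c) + (\<Sum>j\<in>UNIV - {c}. d (x $ j) * v $ j)))
      = reduced_jacobian N k \<epsilon> d c x *v v" for v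
  proof -
    have "(\<Sum>j\<in>UNIV. ((if i = j then 1 - \<epsilon> else 0) + \<epsilon> / real N * (if j = c then real k else 1))
            * d (x $ j) * v $ j)
        = (\<Sum>j\<in>UNIV. (if i = j then (1 - \<epsilon>) * (d (x $ j) * v $ j) else 0)
            + \<epsilon> / real N * ((if j = c then real k else 1) * (d (x $ j) * v $ j)))" for i
      by (intro sum.cong) (auto simp: algebra_simps)
    then show ?thesis
      unfolding vec_eq_iff reduced_jacobian_def matrix_vector_mult_def
      by (simp only: sum_split_off sum.distrib sum_distrib_left[symmetric] vec_lambda_beta) simp
  qed
  ultimately show ?thesis by simp
qed

text \<open>The Jacobian is the coupling matrix times a diagonal matrix. The column weights of the
  coupling matrix add up to \<epsilon>, because the cluster counts \<open>k\<close> times and the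
  other \<open>CARD('d) - 1\<close> sites once, which makes \<open>N\<close> in total; hence
  \<open>det_scalar_plus_constant_columns\<close> applies with
  \<open>s = 1 - \<epsilon>\<close>.\<close>

lemma det_reduced_jacobian:
  fixes x :: "real ^ 'd::finite"
  assumes "0 < N" "CARD('d) + k = N + 1"
  shows "det (reduced_jacobian N k \<epsilon> d c x) = (1 - \<epsilon>) ^ (CARD('d) - 1) * (\<Prod>i\<in>UNIV. d (x $ i))"
proof -
  let ?w = "\<lambda>j. \<epsilon> / real N * (if j = c then real k else 1)"
  let ?L = "\<chi> i j. (if i = j then 1 - \<epsilon> else 0) + ?w j"
  let ?D = "\<chi> i j. if i = j then d (x $ i) else 0"
  have "(\<Sum>j\<in>UNIV. if j = c then real k else 1) = real k + real (CARD('d) - 1)"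
    using sum_split_off[of c "real k" "\<lambda>_. 1"] by simp
  also have "\<dots> = real N"
    using assms by (simp add: of_nat_diff)
  finally have "sum ?w UNIV = \<epsilon>"
    using assms by (simp only: sum_distrib_left[symmetric]) simp
  then have "det ?L = (1 - \<epsilon>) ^ (CARD('d) - 1)"
    by (intro det_scalar_plus_constant_columns) simp
  moreover have "det ?D = (\<Prod>i\<in>UNIV. d (x $ i))"
    by (subst det_diagonal) auto
  moreover have "reduced_jacobian N k \<epsilon> d c x = ?L ** ?D"
    by (simp add: reduced_jacobian_def matrix_matrix_mult_def vec_eq_iff if_distrib[of "(*) _"]
        cong: if_cong)
  ultimately show ?thesis by (simp add: det_mul)
qed

section \<open>Volume of images, for a well-ordered index type\<close>

text \<open>A differentiable map with bounded Jacobian determinant expands volume at most by that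
  bound. Injectivity is not assumed: overlaps only make the image smaller.\<close>

lemma reduced_map_image_measure_le_wellorder:
  fixes S :: "(real ^ 'd::{finite,wellorder}) set"
  assumes "0 < N" "CARD('d) + k = N + 1" "0 \<le> \<epsilon>" "\<epsilon> < 1"
    and S: "S \<in> lmeasurable"
    and deriv: "\<And>x i. x \<in> S \<Longrightarrow> (f has_real_derivative d (x $ i)) (at (x $ i))"
    and bound: "\<And>x i. x \<in> S \<Longrightarrow> \<bar>d (x $ i)\<bar> \<le> t"
  shows "reduced_map N k \<epsilon> f c ` S \<in> lmeasurable"
    and "measure lebesgue (reduced_map N k \<epsilon> f c ` S)
           \<le> (1 - \<epsilon>) ^ (CARD('d) - 1) * t ^ CARD('d) * measure lebesgue S"
proof -
  let ?J = "\<lambda>x. (*v) (reduced_jacobian N k \<epsilon> d c x)"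
  let ?B = "(1 - \<epsilon>) ^ (CARD('d) - 1) * t ^ CARD('d)"
  have der: "(reduced_map N k \<epsilon> f c has_derivative ?J x) (at x within S)" if "x \<in> S" for x
    using deriv[OF that] by (rule reduced_map_has_derivative)
  have le: "\<bar>det (matrix (?J x))\<bar> \<le> ?B" if "x \<in> S" for x
  proof -
    have "(\<Prod>i\<in>UNIV. \<bar>d (x $ i)\<bar>) \<le> (\<Prod>i\<in>(UNIV :: 'd set). t)"
      using bound[OF that] by (intro prod_mono) auto
    then show ?thesis
      using assms(1-4)
      by (simp add: det_reduced_jacobian abs_mult abs_prod power_abs mult_left_mono)
  qed
  \<comment> \<open>The determinant is measurable because it belongs to a derivative on a measurable
    set; being bounded on a set of finite volume, it is integrable.\<close>
  have int: "(\<lambda>x. \<bar>det (matrix (?J x))\<bar>) integrable_on S"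
  proof (rule measurable_bounded_by_integrable_imp_integrable)
    show "(\<lambda>x. \<bar>det (matrix (?J x))\<bar>) \<in> borel_measurable (lebesgue_on S)"
      by (intro borel_measurable_abs fmeasurableD[OF S] der
          borel_measurable_det_Jacobian[where f = "reduced_map N k \<epsilon> f c"])
    show "(\<lambda>_. ?B) integrable_on S"
      using S by (rule integrable_on_const)
    show "norm \<bar>det (matrix (?J x))\<bar> \<le> ?B" if "x \<in> S" for x
      using le[OF that] by simp
  qed (use S in \<open>rule fmeasurableD\<close>)
  show "reduced_map N k \<epsilon> f c ` S \<in> lmeasurable"
    by (rule measurable_bounded_differentiable_image[OF S der int le])
  show "measure lebesgue (reduced_map N k \<epsilon> f c ` S) \<le> ?B * measure lebesgue S"
    by (rule measure_bounded_differentiable_image[OF S der int le])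
qed

section \<open>Transfer of the volume bound to an arbitrary finite index type\<close>

lemma emeasure_lborel_box_cart:
  fixes l u :: "real ^ 'n::finite"
  assumes "\<And>i. l $ i \<le> u $ i"
  shows "emeasure lborel (box l u) = ennreal (\<Prod>i\<in>UNIV. u $ i - l $ i)"
proof -
  have inj: "inj (\<lambda>i::'n. axis i (1::real))"
    by (simp add: inj_on_def axis_eq_axis)
  have basis: "Basis = range (\<lambda>i::'n. axis i (1::real))"
    by (auto simp: Basis_vec_def)
  have "(\<Prod>b\<in>Basis. (u - l) \<bullet> b) = (\<Prod>i\<in>UNIV. u $ i - l $ i)"
    unfolding basis by (subst prod.reindex[OF inj]) (simp add: inner_axis)
  moreover have "l \<bullet> b \<le> u \<bullet> b" if "b \<in> Basis" for b
    using that assms by (auto simp: Basis_vec_def inner_axis)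
  ultimately show ?thesis by simp
qed

definition reindex :: "('n \<Rightarrow> 'm) \<Rightarrow> real ^ 'm \<Rightarrow> real ^ 'n" where
  "reindex g x = (\<chi> i. x $ g i)"

lemma reindex_nth [simp]: "reindex g x $ i = x $ g i"
  by (simp add: reindex_def)

lemma measurable_reindex [measurable]:
  "(reindex g :: real ^ 'm::finite \<Rightarrow> real ^ 'n::finite) \<in> borel \<rightarrow>\<^sub>M borel"
  unfolding reindex_def by (intro borel_measurable_continuous_onI continuous_intros)

text \<open>Lebesgue measure is determined by the volumes of boxes, and relabelling the coordinates
  only permutes the side lengths of a box.\<close>

lemma distr_lborel_reindex:
  fixes g :: "'n::finite \<Rightarrow> 'm::finite"
  assumes "bij g"
  shows "distr lborel borel (reindex g) = lborel"
proof (rule lborel_eqI[symmetric])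
  fix l u :: "real ^ 'n"
  assume le: "\<And>b. b \<in> Basis \<Longrightarrow> l \<bullet> b \<le> u \<bullet> b"
  have le': "l $ i \<le> u $ i" for i
    using le[of "axis i 1"] by (simp add: inner_axis axis_in_Basis_iff)
  let ?h = "inv g"
  have inv: "?h (g i) = i" "g (?h j) = j" for i j
    using assms by (simp_all add: bij_def surj_f_inv_f)
  have "emeasure (distr lborel borel (reindex g)) (box l u)
      = emeasure lborel (reindex g -` box l u)"
    by (subst emeasure_distr) auto
  also have "reindex g -` box l u = box (reindex ?h l) (reindex ?h u)"
  proof (rule set_eqI)
    fix x :: "real ^ 'm"
    have "(\<forall>i. l $ i < x $ g i \<and> x $ g i < u $ i) \<longleftrightarrow> (\<forall>j. l $ ?h j < x $ j \<and> x $ j < u $ ?h j)"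
      by (metis inv)
    then show "x \<in> reindex g -` box l u \<longleftrightarrow> x \<in> box (reindex ?h l) (reindex ?h u)"
      by (simp add: mem_box_cart)
  qed
  also have "emeasure lborel \<dots> = ennreal (\<Prod>j\<in>UNIV. u $ ?h j - l $ ?h j)"
    by (subst emeasure_lborel_box_cart) (simp_all add: le')
  also have "(\<Prod>j\<in>UNIV. u $ ?h j - l $ ?h j) = (\<Prod>i\<in>UNIV. u $ i - l $ i)"
    by (rule prod.reindex_bij_betw) (use assms bij_imp_bij_inv in blast)
  also have "ennreal \<dots> = emeasure lborel (box l u)"
    by (simp add: emeasure_lborel_box_cart le')
  also have "\<dots> = ennreal (\<Prod>b\<in>Basis. (u - l) \<bullet> b)"
    using le by simp
  finally show "emeasure (distr lborel borel (reindex g)) (box l u)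
      = ennreal (\<Prod>b\<in>Basis. (u - l) \<bullet> b)" .
qed simp

lemma emeasure_lborel_reindex_vimage:
  fixes g :: "'n::finite \<Rightarrow> 'm::finite"
  assumes "bij g" and "A \<in> sets borel"
  shows "emeasure lborel (reindex g -` A) = emeasure lborel A"
proof -
  have "emeasure (distr lborel borel (reindex g)) A = emeasure lborel (reindex g -` A)"
    using assms(2) by (subst emeasure_distr) auto
  then show ?thesis by (simp add: distr_lborel_reindex[OF assms(1)])
qed

text \<open>The change-of-variables theorems of the library require the index type of the coordinates to be
  well-ordered; \<open>'a ranked\<close> is a well-ordered copy of an arbitrary finite index type.\<close>

typedef 'a ranked = "UNIV :: 'a set"
  morphisms of_ranked to_ranked ..

lemma of_ranked_to_ranked [simp]: "of_ranked (to_ranked x) = x"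
  and to_ranked_of_ranked [simp]: "to_ranked (of_ranked y) = y"
  by (simp_all add: to_ranked_inverse of_ranked_inverse)

lemma bij_of_ranked: "bij of_ranked" and bij_to_ranked: "bij to_ranked"
  by (rule o_bij[of to_ranked] o_bij[of of_ranked]; simp add: fun_eq_iff)+

instance ranked :: (finite) finite
proof
  show "finite (UNIV :: 'a ranked set)"
    using bij_betw_finite[OF bij_of_ranked[where 'a = 'a]] by simp
qed

instantiation ranked :: (finite) linorder
begin

definition "x \<le> y \<longleftrightarrow> to_nat_on UNIV (of_ranked x) \<le> to_nat_on UNIV (of_ranked y)"
definition "x < y \<longleftrightarrow> to_nat_on UNIV (of_ranked x) < to_nat_on UNIV (of_ranked y)"

instance
proof
  fix x y :: "'a ranked"
  assume "x \<le> y" "y \<le> x"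
  moreover have "inj_on (to_nat_on (UNIV :: 'a set)) UNIV"
    by (rule inj_on_to_nat_on) (simp add: countable_finite)
  ultimately have "of_ranked x = of_ranked y"
    by (auto simp: less_eq_ranked_def dest: injD)
  then show "x = y"
    by (simp add: of_ranked_inject)
qed (auto simp: less_eq_ranked_def less_ranked_def)

end

instance ranked :: (finite) wellorder
proof -
  have "wf {(x :: 'a ranked, y). x < y}"
    by (rule wf_subset[OF wf_measure[of "\<lambda>x. to_nat_on UNIV (of_ranked x)"]])
      (auto simp: less_ranked_def)
  then show "OFCLASS('a ranked, wellorder_class)"
    by (rule wf_wellorderI) intro_classes
qed

text \<open>The reduced map treats all sites other than the cluster alike, so it commutes with any
  relabelling that carries the cluster index along. This lets the volume bound pass between
  \<open>'d\<close> and \<open>'d ranked\<close>.\<close>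

lemma reduced_map_reindex:
  fixes g :: "'n::finite \<Rightarrow> 'm::finite"
  assumes "bij g"
  shows "reduced_map N k \<epsilon> f c (reindex g x) = reindex g (reduced_map N k \<epsilon> f (g c) x)"
proof -
  have "bij_betw g (UNIV - {c}) (UNIV - {g c})"
    using bij_betw_DiffI[OF assms, of "{c}" "{g c}"] by (simp add: bij_betw_def)
  then have "(\<Sum>j\<in>UNIV - {c}. f (x $ g j)) = (\<Sum>j\<in>UNIV - {g c}. f (x $ j))"
    by (rule sum.reindex_bij_betw)
  then show ?thesis by (simp add: reduced_map_def vec_eq_iff)
qed

text \<open>\<open>S\<close> is carried to ranked coordinates, where the volume bound is available,
  and the result is carried back. The conclusion speaks of a Borel superset \<open>H\<close> because
  the image itself is only known to be Lebesgue measurable, whereas the invariant measure lives on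
  Borel sets.\<close>

lemma reduced_map_image_emeasure_le:
  fixes S :: "(real ^ 'd::finite) set" and c :: 'd
  assumes "0 < N" "CARD('d) + k = N + 1" "0 \<le> \<epsilon>" "\<epsilon> < 1" "0 \<le> t"
    and S [measurable]: "S \<in> sets borel" and fin: "emeasure lborel S < \<infinity>"
    and deriv: "\<And>x i. x \<in> S \<Longrightarrow> (f has_real_derivative d (x $ i)) (at (x $ i))"
    and bound: "\<And>x i. x \<in> S \<Longrightarrow> \<bar>d (x $ i)\<bar> \<le> t"
  obtains H where "H \<in> sets borel" "reduced_map N k \<epsilon> f c ` S \<subseteq> H"
    "emeasure lborel H \<le> ennreal ((1 - \<epsilon>) ^ (CARD('d) - 1) * t ^ CARD('d)) * emeasure lborel S"
proof -
  let ?q = "(1 - \<epsilon>) ^ (CARD('d) - 1) * t ^ CARD('d)"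
  let ?F = "reduced_map N k \<epsilon> f (to_ranked c)"
  define S' :: "(real ^ 'd ranked) set" where "S' = reindex to_ranked -` S"
  have S' [measurable]: "S' \<in> sets borel"
    using measurable_sets_borel[OF measurable_reindex S] by (simp add: S'_def)
  have eq: "emeasure lborel S' = emeasure lborel S"
    unfolding S'_def by (rule emeasure_lborel_reindex_vimage[OF bij_to_ranked S])
  have lm: "S' \<in> lmeasurable"
    using fin S' eq by (intro fmeasurableI) auto
  have card: "CARD('d ranked) = CARD('d)"
    using bij_betw_same_card[OF bij_of_ranked] .
  have d': "(f has_real_derivative d (x $ i)) (at (x $ i))" "\<bar>d (x $ i)\<bar> \<le> t" if "x \<in> S'" for x i
    using deriv[of "reindex to_ranked x" "of_ranked i"] bound[of "reindex to_ranked x" "of_ranked i"] that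
    by (simp_all add: S'_def)
  have img: "?F ` S' \<in> lmeasurable"
    and le: "measure lebesgue (?F ` S') \<le> ?q * measure lebesgue S'"
    using reduced_map_image_measure_le_wellorder[of N k \<epsilon> S' f d t "to_ranked c"] assms(1-4) lm d' card
    by simp_all
  \<comment> \<open>A Lebesgue measurable set has a Borel superset of the same measure.\<close>
  obtain H' where H': "H' \<in> sets borel" "?F ` S' \<subseteq> H'"
      "emeasure lebesgue (?F ` S') = emeasure lborel H'"
    by (rule completion_upper[OF fmeasurableD[OF img]]) (rule that; assumption?; simp only: sets_lborel)
  show thesis
  proof
    show "reindex of_ranked -` H' \<in> sets borel"
      by (rule measurable_sets_borel[OF measurable_reindex H'(1)])
    show "reduced_map N k \<epsilon> f c ` S \<subseteq> reindex of_ranked -` H'"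
    proof (intro image_subsetI vimageI2)
      fix x assume "x \<in> S"
      moreover have "reindex to_ranked (reindex of_ranked x) = x"
        by (simp add: vec_eq_iff)
      ultimately have "reindex of_ranked x \<in> S'" by (simp add: S'_def)
      then have "?F (reindex of_ranked x) \<in> H'" using H'(2) by blast
      then show "reindex of_ranked (reduced_map N k \<epsilon> f c x) \<in> H'"
        by (simp add: reduced_map_reindex[OF bij_of_ranked])
    qed
    have "emeasure lborel (reindex of_ranked -` H') = emeasure lebesgue (?F ` S')"
      by (simp only: emeasure_lborel_reindex_vimage[OF bij_of_ranked H'(1)] H'(3))
    also have "\<dots> = ennreal (measure lebesgue (?F ` S'))"
      by (rule emeasure_eq_measure2[OF img])
    also have "\<dots> \<le> ennreal (?q * measure lebesgue S')"
      using le by (rule ennreal_leI)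
    also have "\<dots> = ennreal ?q * ennreal (measure lebesgue S')"
      using assms(3-5) by (intro ennreal_mult) auto
    also have "ennreal (measure lebesgue S') = emeasure lebesgue S'"
      by (rule emeasure_eq_measure2[OF lm, symmetric])
    also have "\<dots> = emeasure lborel S"
      using eq by simp
    finally show "emeasure lborel (reindex of_ranked -` H') \<le> ennreal ?q * emeasure lborel S" .
  qed
qed

section \<open>Differentiability of the local map off a finite set\<close>

lemma finite_interval_minus_interior:
  fixes J :: "real set"
  assumes "is_interval J"
  shows "finite (J - interior J)"
proof -
  have "x = Inf J \<or> x = Sup J" if x: "x \<in> J" "x \<notin> interior J" for x
  proof (rule ccontr)
    assume not_end: "\<not> ?thesis"
    \<comment> \<open>If nothing in \<open>J\<close> lay below \<open>x\<close>, then
      \<open>x\<close> would be the minimum and hence \<open>Inf J\<close>; boundedness of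
      \<open>J\<close> does not enter, although \<open>Inf J\<close> and \<open>Sup J\<close> are
      meaningful only for bounded \<open>J\<close>.\<close>
    obtain y where y: "y \<in> J" "y < x"
      using not_end cInf_eq_minimum[OF x(1)] by (metis not_le)
    obtain z where z: "z \<in> J" "x < z"
      using not_end cSup_eq_maximum[OF x(1)] by (metis not_le)
    have "{y<..<z} \<subseteq> J"
      using assms y z unfolding is_interval_1 by (meson greaterThanLessThan_iff less_imp_le subsetI)
    then have "x \<in> interior J"
      using y z by (intro interiorI[of "{y<..<z}"]) auto
    with x show False by simp
  qed
  then have "J - interior J \<subseteq> {Inf J, Sup J}" by blast
  then show ?thesis by (rule finite_subset) simp
qed

text \<open>\<open>U\<close> is the union of the interiors of the pieces. Only end points of the
  finitely many pieces are lost, and \<open>U\<close> lies in the interior of \<open>{a..b}\<close>,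
  where the supremum is taken.\<close>

lemma piecewise_C1_on_differentiable:
  assumes "piecewise_C1_on f {a..b}"
  obtains U where "open U" "U \<subseteq> {a..b}" "finite ({a..b} - U)"
    "\<And>x. x \<in> U \<Longrightarrow> (f has_real_derivative deriv f x) (at x)"
    "\<And>x. x \<in> U \<Longrightarrow> ereal \<bar>deriv f x\<bar> \<le> sup_abs_deriv f {a..b}"
proof -
  obtain P where P: "finite P" "partition_on {a..b} P"
      "\<And>J. J \<in> P \<Longrightarrow> is_interval J" "\<And>J. J \<in> P \<Longrightarrow> f C1_differentiable_on interior J"
    using assms by (auto simp: piecewise_C1_on_def)
  have Un: "\<Union>P = {a..b}"
    using partition_onD1[OF P(2)] by simp
  let ?U = "\<Union>J\<in>P. interior J"
  have diff: "f field_differentiable at x" if x: "x \<in> ?U" for x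
  proof -
    obtain J where J: "J \<in> P" "x \<in> interior J" using x by blast
    then have "f differentiable at x"
      using P(4) by (auto simp: C1_differentiable_on_eq)
    then show ?thesis
      by (auto simp: field_differentiable_def real_differentiable_def)
  qed
  show thesis
  proof
    show "open ?U" by auto
    show "?U \<subseteq> {a..b}"
      using Un interior_subset by blast
    have "{a..b} - ?U \<subseteq> (\<Union>J\<in>P. J - interior J)"
      using Un by blast
    moreover have "finite (\<Union>J\<in>P. J - interior J)"
      using P(1,3) finite_interval_minus_interior by blast
    ultimately show "finite ({a..b} - ?U)"
      by (rule finite_subset)
    fix x assume x: "x \<in> ?U"
    show "(f has_real_derivative deriv f x) (at x)"
      using diff[OF x] by (simp add: DERIV_deriv_iff_field_differentiable)
    have "x \<in> interior {a..b}"
      using x Un interior_mono[of _ "{a..b}"] by blast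
    then show "ereal \<bar>deriv f x\<bar> \<le> sup_abs_deriv f {a..b}"
      using diff[OF x] unfolding sup_abs_deriv_def by (intro SUP_upper) simp
  qed
qed

section \<open>Invariant measures of maps that contract volume\<close>

text \<open>The contraction is only assumed on a part \<open>Y\<close> of full volume in
  \<open>X\<close>, so in the iteration every new set is cut down to \<open>Y\<close> before the map
  is applied again.\<close>

lemma no_invariant_ac_measure_of_contraction:
  fixes T :: "'a::euclidean_space \<Rightarrow> 'a"
  assumes X: "X \<in> sets borel" "emeasure lborel X < \<infinity>"
    and Y: "Y \<in> sets borel" "Y \<subseteq> X" "X - Y \<in> null_sets lborel"
    and T: "T \<in> restrict_space borel X \<rightarrow>\<^sub>M restrict_space borel X"
    and q: "0 \<le> q" "q < 1"
    and contr: "\<And>S. S \<in> sets borel \<Longrightarrow> S \<subseteq> Y \<Longrightarrow>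
      \<exists>H\<in>sets borel. T ` S \<subseteq> H \<and> emeasure lborel H \<le> ennreal q * emeasure lborel S"
    and M: "prob_space M" "sets M = sets (restrict_space borel X)"
    and inv: "invariant_measure M T"
    and ac: "absolutely_continuous (restrict_space lborel X) M"
  shows False
proof -
  interpret prob_space M by fact
  have space: "space M = X"
    using sets_eq_imp_space_eq[OF M(2)] by (simp add: space_restrict_space)
  have sets: "A \<in> sets M \<longleftrightarrow> A \<in> sets borel \<and> A \<subseteq> X" for A
    using X(1) by (subst M(2)) (auto simp: sets_restrict_space_iff)
  have null: "A \<in> null_sets M" if "A \<in> null_sets lborel" "A \<subseteq> X" for A
    using ac that X(1) unfolding absolutely_continuous_def
    by (metis null_sets_restrict_space sets_lborel subsetD)
  \<comment> \<open>Absolute continuity makes \<open>X - Y\<close> a null set of \<open>M\<close>,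
    so cutting down to \<open>Y\<close> costs no measure.\<close>
  have full_part: "emeasure M (A \<inter> Y) = emeasure M (A \<inter> X)" if "A \<in> sets borel" for A
  proof -
    have "emeasure M (A \<inter> X - (X - Y)) = emeasure M (A \<inter> X)"
      using that X(1) by (intro emeasure_Diff_null_set null[OF Y(3)]) (auto simp: sets)
    moreover have "A \<inter> X - (X - Y) = A \<inter> Y" using Y(2) by blast
    ultimately show ?thesis by simp
  qed
  have X1: "emeasure M X = 1"
    using emeasure_space_1 space by simp
  have "\<exists>A. A \<in> sets borel \<and> A \<subseteq> Y \<and> emeasure M A = 1 \<and>
      emeasure lborel A \<le> ennreal (q ^ n) * emeasure lborel X" for n
  proof (induction n)
    case 0
    have "emeasure M Y = 1"
      using full_part[OF X(1)] Y(2) X1 by (simp add: Int_absorb1)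
    moreover have "emeasure lborel Y \<le> emeasure lborel X"
      using X(1) Y(2) by (intro emeasure_mono) auto
    ultimately show ?case
      using Y(1) by (intro exI[of _ Y]) simp
  next
    case (Suc n)
    then obtain A where A: "A \<in> sets borel" "A \<subseteq> Y" "emeasure M A = 1"
      "emeasure lborel A \<le> ennreal (q ^ n) * emeasure lborel X" by blast
    obtain H where H: "H \<in> sets borel" "T ` A \<subseteq> H"
      "emeasure lborel H \<le> ennreal q * emeasure lborel A"
      using contr[OF A(1,2)] by blast
    have TX: "T ` X \<subseteq> X"
      using measurable_space[OF T] by (auto simp: space_restrict_space)
    have HX: "H \<inter> X \<in> sets M"
      using H(1) X(1) by (auto simp: sets)
    have "T -` (H \<inter> X) \<inter> X \<in> sets M"
      using measurable_sets[OF T, of "H \<inter> X"] HX by (simp add: M(2) space_restrict_space)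
    moreover have "A \<subseteq> T -` (H \<inter> X) \<inter> X"
      using A(2) Y(2) H(2) TX by blast
    \<comment> \<open>Invariance concerns preimages: the preimage of \<open>H \<inter> X\<close>
      contains \<open>A\<close>, so it has full measure, and \<open>H \<inter> X\<close> has the
      same measure.\<close>
    ultimately have "1 \<le> emeasure M (T -` (H \<inter> X) \<inter> X)"
      using emeasure_mono[of A "T -` (H \<inter> X) \<inter> X" M] A(3) by simp
    also have "\<dots> = emeasure M (H \<inter> X)"
      using inv HX unfolding invariant_measure_def space by blast
    also have "\<dots> = emeasure M (H \<inter> Y)"
      using full_part[OF H(1)] by simp
    finally have one: "emeasure M (H \<inter> Y) = 1"
      using emeasure_le_1[of "H \<inter> Y"] by (intro antisym)
    have "emeasure lborel (H \<inter> Y) \<le> emeasure lborel H"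
      using H(1) by (intro emeasure_mono) auto
    also have "\<dots> \<le> ennreal q * emeasure lborel A" by (rule H(3))
    also have "\<dots> \<le> ennreal q * (ennreal (q ^ n) * emeasure lborel X)"
      using A(4) by (rule mult_left_mono) simp
    also have "\<dots> = ennreal (q ^ Suc n) * emeasure lborel X"
      using q(1) by (simp add: ennreal_mult mult.assoc)
    finally show ?case
      using H(1) Y(1) one by (intro exI[of _ "H \<inter> Y"]) simp
  qed
  then obtain A where A: "\<And>n. A n \<in> sets borel" "\<And>n. A n \<subseteq> Y" "\<And>n. emeasure M (A n) = 1"
    "\<And>n. emeasure lborel (A n) \<le> ennreal (q ^ n) * emeasure lborel X" for n :: nat
    by metis
  \<comment> \<open>As a countable intersection of sets of full measure \<open>B\<close> has full
    measure, while its volume is below \<open>q ^ n\<close> times that of \<open>X\<close> for every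
    \<open>n\<close>. Finiteness of the volume of \<open>X\<close> makes these bounds tend to
    0.\<close>
  define B where "B = (\<Inter>n. A n)"
  have "B \<subseteq> A 0" by (auto simp: B_def)
  then have B: "B \<in> sets borel" "B \<subseteq> X"
    using A(1) A(2)[of 0] Y(2) by (auto simp: B_def)
  obtain v where v: "0 \<le> v" "emeasure lborel X = ennreal v"
    using X(2) by (cases "emeasure lborel X") auto
  have le: "emeasure lborel B \<le> ennreal (q ^ n * v)" for n
  proof -
    have "emeasure lborel B \<le> emeasure lborel (A n)"
      using A(1) by (intro emeasure_mono) (auto simp: B_def)
    also have "\<dots> \<le> ennreal (q ^ n * v)"
      using A(4)[of n] v q(1) by (simp add: ennreal_mult)
    finally show ?thesis .
  qed
  have "(\<lambda>n. ennreal (q ^ n * v)) \<longlonglongrightarrow> ennreal (0 * v)"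
    using q by (intro tendsto_ennrealI tendsto_mult_right LIMSEQ_realpow_zero)
  then have "emeasure lborel B \<le> 0"
    using le by (intro LIMSEQ_le_const) auto
  then have "AE x in M. x \<notin> B"
    using B by (intro AE_not_in null) auto
  moreover have "AE x in M. x \<in> A n" for n
    using A(1,2,3) Y(2) by (intro AE_prob_1) (simp add: measure_def)
  then have "AE x in M. x \<in> B"
    unfolding B_def by (simp add: AE_all_countable)
  ultimately have "AE x in M. False"
    by eventually_elim simp
  then show False
    by simp
qed

section \<open>Cubes: invariance and measurability\<close>

lemma cube_eq_cbox: "cube {a..b} = cbox (\<chi> i. a) (\<chi> i. b)"
  by (auto simp: cube_def mem_box_cart)

lemma open_cube:
  assumes "open U"
  shows "open (cube U :: (real ^ 'd::finite) set)"
proof -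
  have "cube U = (\<Inter>i::'d. (\<lambda>x::real^'d. x $ i) -` U)"
    by (auto simp: cube_def)
  then show ?thesis
    using assms by (auto intro!: open_INT open_vimage continuous_intros)
qed

text \<open>A point of the difference has some coordinate in the finite set \<open>I - U\<close>, so
  finitely many coordinate hyperplanes cover the difference.\<close>

lemma negligible_cube_diff:
  assumes "finite (I - U)"
  shows "negligible (cube I - cube U :: (real ^ 'd::finite) set)"
proof -
  have "negligible {x :: real ^ 'd. x $ i = e}" for i e
    using negligible_hyperplane[of "axis i 1 :: real ^ 'd" e] by (simp add: inner_axis')
  then have "negligible (\<Union>i\<in>(UNIV :: 'd set). \<Union>e\<in>I - U. {x. x $ i = e})"
    using assms by (auto intro!: negligible_Union)
  moreover have "cube I - cube U \<subseteq> (\<Union>i\<in>(UNIV :: 'd set). \<Union>e\<in>I - U. {x. x $ i = e})"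
    by (auto simp: cube_def)
  ultimately show ?thesis by (rule negligible_subset)
qed

text \<open>All coefficients are nonnegative. Two local maps \<open>f\<close> and \<open>g\<close>
  are allowed so that \<open>f\<close> can be compared with the constants \<open>a\<close> and
  \<open>b\<close>, which shows in \<open>reduced_map_cube\<close> that the cube is
  invariant.\<close>

lemma reduced_map_mono:
  fixes u v :: "real ^ 'd::finite"
  assumes "0 \<le> \<epsilon>" "\<epsilon> < 1" "\<And>i. f (u $ i) \<le> g (v $ i)"
  shows "reduced_map N k \<epsilon> f c u $ i \<le> reduced_map N k \<epsilon> g c v $ i"
  unfolding reduced_map_def vec_lambda_beta
  using assms by (intro add_mono mult_left_mono sum_mono) auto

text \<open>The coefficients in each coordinate add up to 1, as the multiplicities of the sites add
  up to \<open>N\<close>.\<close>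

lemma reduced_map_const:
  assumes "0 < N" "CARD('d) + k = N + 1"
  shows "reduced_map N k \<epsilon> (\<lambda>_. r) c x = (\<chi> i::'d::finite. r)"
proof -
  have "real k * r + (\<Sum>j\<in>UNIV - {c}. r) = (real k + real (CARD('d) - 1)) * r"
    by (simp add: algebra_simps)
  also have "real k + real (CARD('d) - 1) = real N"
    using assms by (simp add: of_nat_diff)
  finally show ?thesis
    using assms(1) by (simp add: reduced_map_def vec_eq_iff algebra_simps)
qed

lemma reduced_map_cube:
  fixes x :: "real ^ 'd::finite"
  assumes "0 < N" "CARD('d) + k = N + 1" "0 \<le> \<epsilon>" "\<epsilon> < 1" "f ` {a..b} \<subseteq> {a..b}"
    and x: "x \<in> cube {a..b}"
  shows "reduced_map N k \<epsilon> f c x \<in> cube {a..b}"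
proof -
  have f: "a \<le> f (x $ i)" "f (x $ i) \<le> b" for i
    using assms(5) x by (auto simp: cube_def image_subset_iff)
  have "a \<le> reduced_map N k \<epsilon> f c x $ i" for i
    using reduced_map_mono[of \<epsilon> "\<lambda>_. a" x f x N k c i] assms(1-4) f
    by (simp add: reduced_map_const)
  moreover have "reduced_map N k \<epsilon> f c x $ i \<le> b" for i
    using reduced_map_mono[of \<epsilon> f x "\<lambda>_. b" x N k c i] assms(1-4) f
    by (simp add: reduced_map_const)
  ultimately show ?thesis by (simp add: cube_def)
qed

lemma borel_measurable_reduced_map:
  assumes [measurable]: "g \<in> borel_measurable borel"
  shows "(reduced_map N k \<epsilon> g c :: real ^ 'd::finite \<Rightarrow> real ^ 'd) \<in> borel \<rightarrow>\<^sub>M borel"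
proof (subst borel_measurable_euclidean_space, intro ballI)
  fix e :: "real ^ 'd" assume "e \<in> Basis"
  then obtain i where e: "e = axis i 1" by (auto simp: Basis_vec_def)
  have [measurable]: "(\<lambda>x :: real ^ 'd. x $ j) \<in> borel_measurable borel" for j
    by (intro borel_measurable_continuous_onI continuous_intros)
  have "(\<lambda>x. reduced_map N k \<epsilon> g c x $ i) \<in> borel_measurable borel"
    unfolding reduced_map_def vec_lambda_beta by measurable
  then show "(\<lambda>x. reduced_map N k \<epsilon> g c x \<bullet> e) \<in> borel_measurable borel"
    by (simp add: e inner_axis)
qed

text \<open>Nothing is known of \<open>f\<close> outside \<open>I\<close>, so it is replaced there
  by 0. The result is continuous on the open sets \<open>U\<close> and \<open>- I\<close>, hence off
  the countable set \<open>I - U\<close>.\<close>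

lemma borel_measurable_extend_by_zero:
  fixes f :: "real \<Rightarrow> real"
  assumes "closed I" "open U" "U \<subseteq> I" "countable (I - U)" "continuous_on U f"
  shows "(\<lambda>x. if x \<in> I then f x else 0) \<in> borel_measurable borel"
proof (rule borel_measurable_continuous_countable_exceptions[OF assms(4)])
  let ?g = "\<lambda>x. if x \<in> I then f x else 0"
  have "continuous_on U ?g"
    by (rule continuous_on_eq[OF assms(5)]) (use assms(3) in auto)
  moreover have "continuous_on (- I) ?g"
    by (rule continuous_on_eq[OF continuous_on_const[of _ 0]]) simp
  ultimately have "continuous_on (U \<union> - I) ?g"
    using assms(1,2) by (intro continuous_on_open_Un) auto
  moreover have "- (I - U) = U \<union> - I" by blast
  ultimately show "continuous_on (- (I - U)) ?g" by simp
qed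

lemma reduced_map_measurable:
  fixes c :: "'d::finite"
  assumes "0 < N" "CARD('d) + k = N + 1" "0 \<le> \<epsilon>" "\<epsilon> < 1" "f ` {a..b} \<subseteq> {a..b}"
    and g: "(\<lambda>x. if x \<in> {a..b} then f x else 0) \<in> borel_measurable borel"
  shows "reduced_map N k \<epsilon> f c
    \<in> restrict_space borel (cube {a..b}) \<rightarrow>\<^sub>M restrict_space borel (cube {a..b})"
proof (rule measurable_restrict_space2)
  show "reduced_map N k \<epsilon> f c \<in> space (restrict_space borel (cube {a..b})) \<rightarrow> cube {a..b}"
    using reduced_map_cube[OF assms(1-5)] by (auto simp: space_restrict_space)
  have "reduced_map N k \<epsilon> f c x = reduced_map N k \<epsilon> (\<lambda>x. if x \<in> {a..b} then f x else 0) c x"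
    if "x \<in> cube {a..b}" for x
    using that by (simp add: reduced_map_def cube_def)
  then show "reduced_map N k \<epsilon> f c \<in> borel_measurable (restrict_space borel (cube {a..b}))"
    using measurable_restrict_space1[OF borel_measurable_reduced_map[OF g]]
    by (subst measurable_cong) (auto simp: space_restrict_space)
qed

section \<open>The contraction rate and the conclusion\<close>

text \<open>The exponent is chosen so that the power \<open>N - k + 1\<close> of the threshold is
  the inverse of \<open>(1 - \<epsilon>) ^ (N - k)\<close>. A real \<open>t\<close> strictly below
  the threshold therefore gives a Jacobian bound strictly below 1.\<close>

lemma contraction_rate:
  fixes s :: ereal
  assumes "k \<le> N" "\<epsilon> < 1"
    and "s < ereal ((1 - \<epsilon>) powr ((real k - real N) / (real N - real k + 1)))"
  obtains t where "0 \<le> t" "s \<le> ereal t" "(1 - \<epsilon>) ^ (N - k) * t ^ (N - k + 1) < 1"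
proof -
  let ?n = "N - k + 1"
  let ?r = "(1 - \<epsilon>) powr ((real k - real N) / (real N - real k + 1))"
  have r: "0 < ?r" using assms(2) by simp
  obtain t0 where t0: "s < ereal t0" "t0 < ?r"
    using ereal_dense2[OF assms(3)] by auto
  \<comment> \<open>\<open>t0\<close> may be negative, for instance when \<open>s\<close> is the
    supremum of the empty set, which is minus infinity in \<open>ereal\<close>; the threshold is
    positive, so the maximum stays below it.\<close>
  define t where "t = max 0 t0"
  have t: "0 \<le> t" "t < ?r" "s \<le> ereal t"
    using t0 r by (auto simp: t_def max_def intro: order.trans less_imp_le)
  have "?r ^ ?n = (1 - \<epsilon>) powr ((real k - real N) / (real N - real k + 1) * real ?n)"
    by (simp only: powr_realpow[OF r, symmetric] powr_powr)
  also have "(real k - real N) / (real N - real k + 1) * real ?n = - real (N - k)"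
  proof -
    have "real ?n = real N - real k + 1" "real N - real k + 1 \<noteq> 0"
      using assms(1) by (simp_all add: of_nat_diff)
    then have "(real k - real N) / (real N - real k + 1) * real ?n = real k - real N"
      by (metis nonzero_eq_divide_eq)
    then show ?thesis
      using assms(1) by (simp only: of_nat_diff)
  qed
  also have "(1 - \<epsilon>) powr - real (N - k) = inverse ((1 - \<epsilon>) ^ (N - k))"
    using assms(2) by (simp add: powr_minus powr_realpow)
  finally have "t ^ ?n < inverse ((1 - \<epsilon>) ^ (N - k))"
    using power_strict_mono[OF t(2,1), of ?n] by simp
  then have "(1 - \<epsilon>) ^ (N - k) * t ^ ?n < 1"
    using assms(2) by (simp add: field_simps)
  with t that show thesis by blast
qed

theorem mainTheorem3:
  fixes N k :: nat and \<epsilon> a b :: real and f :: "real \<Rightarrow> real" and c :: "'d::finite"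
  assumes "N \<ge> 2" and "2 \<le> k" and "k \<le> N"
    and "CARD('d) = N - k + 1"
    and "0 \<le> \<epsilon>" and "\<epsilon> < 1"
    and "a \<le> b"
    and "f ` {a..b} \<subseteq> {a..b}"
    and "piecewise_C1_on f {a..b}"
    and "sup_abs_deriv f {a..b}
           < ereal ((1 - \<epsilon>) powr ((real k - real N) / (real N - real k + 1)))"
  shows "\<not> (\<exists>M :: (real ^ 'd) measure.
            prob_space M \<and>
            sets M = sets (restrict_space borel (cube {a..b})) \<and>
            invariant_measure M (reduced_map N k \<epsilon> f c) \<and>
            absolutely_continuous (restrict_space lborel (cube {a..b})) M)"
proof (rule notI, elim exE conjE)
  fix M :: "(real ^ 'd) measure"
  assume M: "prob_space M" "sets M = sets (restrict_space borel (cube {a..b}))"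
    and inv: "invariant_measure M (reduced_map N k \<epsilon> f c)"
    and ac: "absolutely_continuous (restrict_space lborel (cube {a..b})) M"
  \<comment> \<open>The dimension is restated without truncated subtraction.\<close>
  have N: "0 < N" "CARD('d) + k = N + 1" using assms by auto
  obtain U where U: "open U" "U \<subseteq> {a..b}" "finite ({a..b} - U)"
    "\<And>x. x \<in> U \<Longrightarrow> (f has_real_derivative deriv f x) (at x)"
    "\<And>x. x \<in> U \<Longrightarrow> ereal \<bar>deriv f x\<bar> \<le> sup_abs_deriv f {a..b}"
    using piecewise_C1_on_differentiable[OF assms(9)] by metis
  obtain t where t: "0 \<le> t" "sup_abs_deriv f {a..b} \<le> ereal t"
    "(1 - \<epsilon>) ^ (N - k) * t ^ (N - k + 1) < 1"
    using contraction_rate[OF assms(3,6,10)] by metis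
  have t': "\<bar>deriv f x\<bar> \<le> t" if "x \<in> U" for x
    using order.trans[OF U(5)[OF that] t(2)] by simp
  have contU: "continuous_on U f"
    using U(4) by (meson DERIV_isCont continuous_at_imp_continuous_on)
  let ?q = "(1 - \<epsilon>) ^ (CARD('d) - 1) * t ^ CARD('d)"
  have q: "0 \<le> ?q" "?q < 1"
    using t(1,3) assms(4,6) by simp_all
  let ?X = "cube {a..b} :: (real ^ 'd) set"
  let ?Y = "cube U :: (real ^ 'd) set"
  have X: "?X \<in> sets borel" and fin: "emeasure lborel ?X < \<infinity>"
    by (simp_all add: cube_eq_cbox emeasure_lborel_cbox_eq)
  have Y: "?Y \<in> sets borel"
    by (rule borel_open[OF open_cube[OF U(1)]])
  have sub: "?Y \<subseteq> ?X"
    using U(2) by (auto simp: cube_def)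
  have "negligible (?X - ?Y)"
    by (rule negligible_cube_diff[OF U(3)])
  \<comment> \<open>Negligible means null for the completed measure; since the difference is Borel,
    it is null for \<open>lborel\<close> as well.\<close>
  then have diff: "?X - ?Y \<in> null_sets lborel"
    using sets.Diff[OF X Y] by (simp add: negligible_iff_null_sets null_sets_completion_iff)
  have "\<exists>H\<in>sets borel. reduced_map N k \<epsilon> f c ` S \<subseteq> H \<and>
      emeasure lborel H \<le> ennreal ?q * emeasure lborel S"
    if S: "S \<in> sets borel" "S \<subseteq> ?Y" for S
  proof -
    have "emeasure lborel S \<le> emeasure lborel ?X"
      using S sub X by (intro emeasure_mono) auto
    then have finS: "emeasure lborel S < \<infinity>"
      using fin by simp
    have SU: "x $ i \<in> U" if "x \<in> S" for x i
      using S(2) that by (auto simp: cube_def)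
    show ?thesis
      by (rule reduced_map_image_emeasure_le[of N k \<epsilon> t S f "deriv f" c,
            OF N assms(5,6) t(1) S(1) finS U(4)[OF SU] t'[OF SU]]) blast+
  qed
  moreover have "reduced_map N k \<epsilon> f c \<in> restrict_space borel ?X \<rightarrow>\<^sub>M restrict_space borel ?X"
    by (intro reduced_map_measurable N assms(5,6,8) closed_atLeastAtMost
        borel_measurable_extend_by_zero[OF _ U(1,2) countable_finite[OF U(3)] contU])
  ultimately show False
    using no_invariant_ac_measure_of_contraction[OF X fin Y sub diff _ q _ M inv ac] by blast
qed

end
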